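(* Let $n\ge 1$, let $f_1,\dots,f_n:\mathsf H\to\mathbb R$ be functions on a separable real Hilbert space $\mathsf H$, let $F=\frac1n\sum_{i=1}^n f_i$, and assume $\operatorname{argmin}F\neq\varnothing$. Assume that each $f_i$ is convex and $L$-smooth for some $L>0$. Let $(\boldsymbol x^k)_{k\in\mathbb N}$ be generated by the L-SVRP algorithm described in the context, with parameter $p\in\,]0,1]$ and step size $\alpha$. Let $M\ge\frac2p$ and let $\alpha>0$ be such that $\alpha<\frac1{L(2+pM)}$. Then, for all integers $k\ge1$, $$\mathsf E\big[F(\bar{\boldsymbol x}^k)-F_*\big]\le\frac{\operatorname{dist}(\boldsymbol x^0,\operatorname{argmin}F)^2+\alpha^2M\,\mathsf E[\sigma_0^2]}{2\alpha k\,[1-\alpha L(2+pM)]},\qquad\bar{\boldsymbol x}^k=\frac1k\sum_{t=0}^{k-1}\boldsymbol x^t,$$ where $\sigma_0^2=\frac1n\sum_{i=1}^n\|\nabla f_i(\boldsymbol u^0)-\nabla f_i(\boldsymbol y^0)\|^2$ and $\boldsymbol y^0\in\operatorname{argmin}F$ is such that $\|\boldsymbol u^0-\boldsymbol y^0\|=\operatorname{dist}(\boldsymbol u^0,\operatorname{argmin}F)$.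
   Context: Notation: $F_*=\inf F$; $\operatorname{dist}(x,S)=\inf_{z\in S}\|x-z\|$; $\operatorname{prox}_{\varphi}(x)=\operatorname{argmin}_{y\in\mathsf H}\{\varphi(y)+\frac12\|y-x\|^2\}$. A function $f$ is $L$-smooth if it is differentiable and $\|\nabla f(x)-\nabla f(y)\|\le L\|x-y\|$ for all $x,y\in\mathsf H$. L-SVRP algorithm: $(i_k)_{k\in\mathbb N}$ is a sequence of i.i.d. random variables uniformly distributed on $\{1,\dots,n\}$, and $(\varepsilon^k)_{k\in\mathbb N}$ is a sequence of i.i.d. Bernoulli random variables with $\mathsf P(\varepsilon^k=1)=p\in\,]0,1]$; with $\mathfrak F_k=\sigma(i_0,\dots,i_{k-1},\varepsilon^0,\dots,\varepsilon^{k-1})$, both $i_k$ and $\varepsilon^k$ are independent of $\mathfrak F_k$. Let $\alpha>0$ and let the (deterministic) initial points be $\boldsymbol x^0=\boldsymbol u^0\in\mathsf H$. For $k=0,1,\dots$ $$\boldsymbol x^{k+1}=\operatorname{prox}_{\alpha f_{i_k}}\big(\boldsymbol x^k+\alpha\nabla f_{i_k}(\boldsymbol u^k)-\alpha\nabla F(\boldsymbol u^k)\big),\qquad\boldsymbol u^{k+1}=(1-\varepsilon^k)\boldsymbol u^k+\varepsilon^k\boldsymbol x^k.$$ *)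

theory Defs
  imports "HOL-Probability.Probability"
begin

definition argmin_set :: "('a \<Rightarrow> real) \<Rightarrow> 'a set" where
  "argmin_set g = {x. is_arg_min g (\<lambda>_. True) x}"

(* Meaningful where g is differentiable; the gradient is then unique. *)
definition grad :: "('a::real_inner \<Rightarrow> real) \<Rightarrow> 'a \<Rightarrow> 'a" where
  "grad g x = (THE D. GDERIV g x :> D)"

definition L_smooth :: "real \<Rightarrow> ('a::real_inner \<Rightarrow> real) \<Rightarrow> bool" where
  "L_smooth L g \<longleftrightarrow>
     (\<forall>x. g differentiable (at x)) \<and>
     (\<forall>x y. norm (grad g x - grad g y) \<le> L * norm (x - y))"

(* The library's arg_min picks some minimizer. For convex continuous g on a Hilbert space
   the minimizer exists and is unique, so this is the proximity operator. *)
definition prox :: "('a::real_inner \<Rightarrow> real) \<Rightarrow> 'a \<Rightarrow> 'a" where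
  "prox g x = (ARG_MIN (\<lambda>y. g y + 1 / 2 * (norm (y - x))\<^sup>2) y. True)"

(* The sigma-algebra generated by i_0, ..., i_(k-1), eps_0, ..., eps_(k-1), as a set of events. *)
definition past_events ::
  "'w measure \<Rightarrow> (nat \<Rightarrow> 'w \<Rightarrow> nat) \<Rightarrow> (nat \<Rightarrow> 'w \<Rightarrow> bool) \<Rightarrow> nat \<Rightarrow> 'w set set" where
  "past_events \<P> idx eps k = sigma_sets (space \<P>)
     ({idx j -` A \<inter> space \<P> | j A. j < k} \<union> {eps j -` A \<inter> space \<P> | j A. j < k})"

(* The sigma-algebra generated by a discrete random variable, as a set of events. *)
definition generated_events :: "'w measure \<Rightarrow> ('w \<Rightarrow> 'b) \<Rightarrow> 'w set set" where
  "generated_events \<P> X = {X -` A \<inter> space \<P> | A. True}"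

end

theory Submission
  imports Defs
begin

text \<open>
  Fix one minimizer \<open>y\<close> of \<open>F\<close>. The prox step solves
  \<open>x\<^sup>+ = x - \<alpha> (\<nabla>f\<^sub>i(x\<^sup>+) + \<nabla>F(u) - \<nabla>f\<^sub>i(u))\<close>, so convexity at \<open>x\<^sup>+\<close> and at \<open>x\<close>
  bounds \<open>\<parallel>x\<^sup>+ - y\<parallel>\<^sup>2\<close>; averaging over \<open>i\<close> and using cocoercivity gives
  \<open>E\<parallel>x\<^sup>+ - y\<parallel>\<^sup>2 \<le> \<parallel>x - y\<parallel>\<^sup>2 - 2\<alpha>(1 - 2\<alpha>L)(F x - F y) + 2\<alpha>\<^sup>2 \<sigma>\<^sup>2(u)\<close>, while the update
  of \<open>u\<close> gives \<open>E \<sigma>\<^sup>2(u\<^sup>+) \<le> (1 - p) \<sigma>\<^sup>2(u) + 2pL(F x - F y)\<close>. Since \<open>M \<ge> 2/p\<close>, the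
  quantity \<open>\<parallel>x - y\<parallel>\<^sup>2 + \<alpha>\<^sup>2 M \<sigma>\<^sup>2(u)\<close> decreases in mean by at least
  \<open>2\<alpha>(1 - \<alpha>L(2 + pM)) E[F x - F y]\<close>; telescoping and Jensen's inequality conclude.

  The iterates after \<open>k\<close> steps are a function of the \<open>k\<close> past samples, which almost surely
  take finitely many values. Hence all expectations are finite sums.
\<close>

section \<open>Gradients of convex smooth functions\<close>

text \<open>The representing vector is the minimizer of the energy \<open>1/2 |y|^2 - D y\<close>;
  its first-order condition is the claim. This turns Frechet derivatives into gradient
  vectors.\<close>

lemma riesz_representation:
  fixes D :: "'a::{real_inner, banach} \<Rightarrow> real"
  assumes "bounded_linear D"
  shows "\<exists>d. \<forall>h. D h = inner h d"
proof -
  interpret D: bounded_linear D by fact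
  define q where "q y = 1 / 2 * (norm y)\<^sup>2 - D y" for y
  obtain K where K: "\<And>y. norm (D y) \<le> norm y * K" using D.bounded by blast
  \<comment> \<open>Completing the square in \<open>norm y\<close> bounds the energy below, so its
    infimum is finite.\<close>
  have low: "- (K\<^sup>2 / 2) \<le> q y" for y
  proof -
    have "D y \<le> norm y * K" using K[of y] by simp
    moreover have "0 \<le> (norm y - K)\<^sup>2" by simp
    ultimately show ?thesis unfolding q_def by (simp add: power2_eq_square field_simps)
  qed
  define m where "m = Inf (range q)"
  have bdd: "bdd_below (range q)" using low by (auto intro!: bdd_belowI)
  have m_le: "m \<le> q y" for y unfolding m_def by (rule cINF_lower[OF bdd]) simp
  define r where "r j = 1 / real (Suc j)" for j
  have rpos: "0 < r j" for j by (simp add: r_def)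
  have "\<exists>y. q y < m + r j" for j
    using cInf_lessD[of "range q" "m + r j"] rpos[of j] by (auto simp: m_def)
  then obtain Y where Y: "\<And>j. q (Y j) < m + r j" by metis
  \<comment> \<open>Parallelogram law: the energy at the midpoint is at least \<open>m\<close>,
    which forces two near-minimizers to be close.\<close>
  have mid: "(norm (a - b))\<^sup>2 \<le> 4 * (q a - m) + 4 * (q b - m)" for a b
  proof -
    have "q ((1/2) *\<^sub>R (a + b)) = (q a + q b) / 2 - (norm (a - b))\<^sup>2 / 8"
      unfolding q_def D.scaleR D.add power2_norm_eq_inner
      by (simp add: inner_simps inner_commute field_simps)
    with m_le[of "(1/2) *\<^sub>R (a + b)"] show ?thesis by (simp add: field_simps)
  qed
  have inv0: "(\<lambda>j. r j) \<longlonglongrightarrow> 0"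
    using LIMSEQ_inverse_real_of_nat by (simp add: r_def inverse_eq_divide)
  have "Cauchy Y"
  proof (rule metric_CauchyI)
    fix e :: real assume e: "e > 0"
    \<comment> \<open>The constant 8: two energy gaps below \<open>e^2 / 8\<close>, each multiplied
      by 4 in \<open>mid\<close>, add up to less than \<open>e^2\<close>.\<close>
    have "eventually (\<lambda>j. r j < e\<^sup>2 / 8) sequentially"
      using order_tendstoD(2)[OF inv0, of "e\<^sup>2 / 8"] e by simp
    then obtain N where N: "\<And>j. j \<ge> N \<Longrightarrow> r j < e\<^sup>2 / 8"
      by (auto simp: eventually_sequentially)
    show "\<exists>N. \<forall>i\<ge>N. \<forall>j\<ge>N. dist (Y i) (Y j) < e"
    proof (intro exI allI impI)
      fix i j assume ij: "i \<ge> N" "j \<ge> N"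
      have "q (Y i) - m < e\<^sup>2 / 8" "q (Y j) - m < e\<^sup>2 / 8"
        using Y[of i] Y[of j] N[OF ij(1)] N[OF ij(2)] by linarith+
      with mid[of "Y i" "Y j"] have "(norm (Y i - Y j))\<^sup>2 < e\<^sup>2" by simp
      then show "dist (Y i) (Y j) < e"
        using e by (simp add: dist_norm power_less_imp_less_base)
    qed
  qed
  then obtain d where d: "Y \<longlonglongrightarrow> d" by (auto dest: Cauchy_convergent convergentD)
  have "(\<lambda>j. q (Y j)) \<longlonglongrightarrow> q d"
    unfolding q_def by (intro tendsto_intros d D.tendsto)
  moreover have "(\<lambda>j. m + r j) \<longlonglongrightarrow> m + 0"
    by (intro tendsto_intros inv0)
  ultimately have "q d \<le> m + 0"
    by (rule LIMSEQ_le) (use Y in \<open>auto intro: less_imp_le\<close>)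
  then have min: "q d \<le> q y" for y using m_le[of y] by simp
  have "(q has_derivative (\<lambda>h. inner h d - D h)) (at d)"
    unfolding q_def power2_norm_eq_inner
    by (auto intro!: derivative_eq_intros D.has_derivative simp: inner_commute)
  then have "(\<lambda>h. inner h d - D h) = (\<lambda>h. 0)"
    using differential_zero_maxmin[of d UNIV q] min by simp
  then show ?thesis by (metis eq_iff_diff_eq_0)
qed

section \<open>Uniqueness and existence of gradients; tangent inequality for convex
  functions\<close>

lemma GDERIV_unique: "GDERIV g x :> D \<Longrightarrow> GDERIV g x :> D' \<Longrightarrow> D = D'"
proof -
  assume "GDERIV g x :> D" "GDERIV g x :> D'"
  then have "(\<lambda>h. inner h D) = (\<lambda>h. inner h D')"
    unfolding gderiv_def by (rule has_derivative_unique)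
  then have "inner (D - D') (D - D') = 0"
    by (metis inner_diff_right right_minus_eq)
  then show ?thesis by simp
qed

lemma grad_eqI: "GDERIV g x :> D \<Longrightarrow> grad g x = D"
  unfolding grad_def using GDERIV_unique by blast

lemma GDERIV_grad:
  fixes g :: "'a::{real_inner, banach} \<Rightarrow> real"
  assumes "g differentiable (at x)"
  shows "GDERIV g x :> grad g x"
proof -
  from assms obtain D where D: "(g has_derivative D) (at x)"
    by (auto simp: differentiable_def)
  then obtain d where "\<forall>h. D h = inner h d"
    using riesz_representation has_derivative_bounded_linear by blast
  then have "D = (\<lambda>h. inner h d)" by auto
  with D have "GDERIV g x :> d" by (simp add: gderiv_def)
  then show ?thesis using grad_eqI by metis
qed

lemma GDERIV_minimum_eq_0:
  assumes "GDERIV g x :> D" and "\<And>y. g x \<le> g y"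
  shows "D = 0"
proof -
  have "(\<lambda>h. inner h D) = (\<lambda>h. 0)"
    using assms differential_zero_maxmin[of x UNIV g] by (simp add: gderiv_def)
  then show ?thesis by (metis inner_eq_zero_iff)
qed

lemma GDERIV_line:
  assumes "GDERIV g (x + t *\<^sub>R d) :> D"
  shows "((\<lambda>t. g (x + t *\<^sub>R d)) has_real_derivative inner d D) (at t)"
proof -
  have "((\<lambda>t. x + t *\<^sub>R d) has_derivative (\<lambda>h. h *\<^sub>R d)) (at t)"
    by (auto intro!: derivative_eq_intros)
  from has_derivative_compose[OF this assms[unfolded gderiv_def]]
  have "((\<lambda>t. g (x + t *\<^sub>R d)) has_derivative (\<lambda>h. inner (h *\<^sub>R d) D)) (at t)" .
  then show ?thesis
    by (simp add: has_field_derivative_def mult_commute_abs)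
qed

text \<open>Restricting \<open>g\<close> to the line through \<open>x\<close> and \<open>y\<close>
  reduces this to the tangent inequality of a convex function of one variable, taken at 0 and
  evaluated at 1.\<close>

lemma convex_GDERIV_le:
  assumes cvx: "convex_on UNIV g" and D: "GDERIV g x :> D"
  shows "g x + inner (y - x) D \<le> g y"
proof -
  let ?\<phi> = "\<lambda>t. g (x + t *\<^sub>R (y - x))"
  have "convex_on UNIV ?\<phi>"
  proof (rule convex_onI)
    fix t a b :: real assume t: "0 < t" "t < 1"
    have "x + ((1 - t) *\<^sub>R a + t *\<^sub>R b) *\<^sub>R (y - x)
        = (1 - t) *\<^sub>R (x + a *\<^sub>R (y - x)) + t *\<^sub>R (x + b *\<^sub>R (y - x))"
      by (simp add: algebra_simps)
    then show "?\<phi> ((1 - t) *\<^sub>R a + t *\<^sub>R b) \<le> (1 - t) * ?\<phi> a + t * ?\<phi> b"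
      using convex_onD[OF cvx, of t] t by simp
  qed simp
  moreover have "(?\<phi> has_real_derivative inner (y - x) D) (at 0)"
    using GDERIV_line[of g x 0 "y - x" D] D by simp
  ultimately show ?thesis
    using convex_on_imp_above_tangent[of UNIV ?\<phi> 0 1 "inner (y - x) D"] by simp
qed

section \<open>Inequalities for functions with Lipschitz gradient, and the proximity
  operator\<close>

lemma L_smooth_GDERIV:
  fixes g :: "'a::{real_inner, banach} \<Rightarrow> real"
  shows "L_smooth L g \<Longrightarrow> GDERIV g x :> grad g x"
  by (simp add: L_smooth_def GDERIV_grad)

lemma L_smooth_lipschitz: "L_smooth L g \<Longrightarrow> norm (grad g x - grad g y) \<le> L * norm (x - y)"
  by (simp add: L_smooth_def)

text \<open>Along the segment, \<open>g\<close> minus the linear and quadratic terms of the bound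
  has nonpositive derivative, by Cauchy-Schwarz and the Lipschitz property; compare its values at 1
  and 0.\<close>

lemma descent_lemma:
  fixes g :: "'a::{real_inner, banach} \<Rightarrow> real"
  assumes sm: "L_smooth L g"
  shows "g (x + d) \<le> g x + inner d (grad g x) + L / 2 * (norm d)\<^sup>2"
proof -
  let ?\<phi> = "\<lambda>t. g (x + t *\<^sub>R d) - t * inner d (grad g x) - L / 2 * t\<^sup>2 * (norm d)\<^sup>2"
  have "?\<phi> 1 \<le> ?\<phi> 0"
  proof (rule DERIV_nonpos_imp_nonincreasing[of 0 1])
    fix t :: real assume t: "0 \<le> t" "t \<le> 1"
    let ?D = "inner d (grad g (x + t *\<^sub>R d)) - inner d (grad g x) - L * t * (norm d)\<^sup>2"
    have "(?\<phi> has_real_derivative ?D) (at t)"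
      by (auto intro!: derivative_eq_intros GDERIV_line L_smooth_GDERIV[OF sm])
    moreover have "?D \<le> 0"
    proof -
      have "inner d (grad g (x + t *\<^sub>R d) - grad g x)
          \<le> norm d * norm (grad g (x + t *\<^sub>R d) - grad g x)"
        by (rule norm_cauchy_schwarz)
      also have "\<dots> \<le> norm d * (L * norm (t *\<^sub>R d))"
        using L_smooth_lipschitz[OF sm, of "x + t *\<^sub>R d" x]
        by (intro mult_left_mono) auto
      also have "\<dots> = L * t * (norm d)\<^sup>2" using t by (simp add: power2_eq_square)
      finally show ?thesis by (simp add: inner_diff_right)
    qed
    ultimately show "\<exists>D. (?\<phi> has_real_derivative D) (at t) \<and> D \<le> 0" by blast
  qed simp
  then show ?thesis by simp
qed

text \<open>After subtracting the linear part at \<open>x\<close>, the gradient of \<open>g\<close>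
  at \<open>y\<close> is \<open>w\<close>, and \<open>z\<close> is one gradient step of length
  \<open>1 / L\<close> from \<open>y\<close>. Convexity bounds \<open>g z\<close> from below by the
  tangent at \<open>x\<close>, the descent lemma bounds it from above.\<close>

lemma cocoercivity:
  fixes g :: "'a::{real_inner, banach} \<Rightarrow> real"
  assumes sm: "L_smooth L g" and cvx: "convex_on UNIV g" and L: "L > 0"
  shows "(norm (grad g y - grad g x))\<^sup>2 \<le> 2 * L * (g y - g x - inner (y - x) (grad g x))"
proof -
  define w where "w = grad g y - grad g x"
  define z where "z = y - (1 / L) *\<^sub>R w"
  have "g x + inner (z - x) (grad g x) \<le> g z"
    by (rule convex_GDERIV_le[OF cvx L_smooth_GDERIV[OF sm]])
  also have "g z \<le> g y + inner (- (1 / L) *\<^sub>R w) (grad g y) + L / 2 * (norm (- (1 / L) *\<^sub>R w))\<^sup>2"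
    using descent_lemma[OF sm, of y "- (1 / L) *\<^sub>R w"] by (simp add: z_def)
  also have "(norm (- (1 / L) *\<^sub>R w))\<^sup>2 = (norm w)\<^sup>2 / L\<^sup>2"
    by (simp add: power_divide)
  finally have "g x + inner (y - x) (grad g x) + (1 / L) * inner w w
      \<le> g y + L / 2 * ((norm w)\<^sup>2 / L\<^sup>2)"
    by (simp add: z_def w_def inner_diff_left inner_diff_right inner_commute algebra_simps)
  moreover have "L / 2 * ((norm w)\<^sup>2 / L\<^sup>2) = (norm w)\<^sup>2 / (2 * L)"
    using L by (simp add: power2_eq_square)
  moreover have "(1 / L) * inner w w = (norm w)\<^sup>2 / (2 * L) + (norm w)\<^sup>2 / (2 * L)"
    by (simp add: power2_norm_eq_inner)
  ultimately have "(norm w)\<^sup>2 / (2 * L) \<le> g y - g x - inner (y - x) (grad g x)"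
    by linarith
  then show ?thesis using L by (simp add: w_def field_simps)
qed

text \<open>A fixed point of the contraction \<open>y \<mapsto> z - a \<nabla>g(y)\<close> is a minimizer, hence the choice made
  by \<^const>\<open>prox\<close> is a minimizer as well.\<close>
lemma prox_stationary:
  fixes g :: "'a::{real_inner, banach} \<Rightarrow> real"
  assumes sm: "L_smooth L g" and cvx: "convex_on UNIV g" and a: "0 < a" "a * L < 1" and L: "L > 0"
  shows "prox (\<lambda>y. a * g y) z = z - a *\<^sub>R grad g (prox (\<lambda>y. a * g y) z)"
proof -
  let ?\<psi> = "\<lambda>y. a * g y + 1 / 2 * (norm (y - z))\<^sup>2"
  have "\<exists>!y. z - a *\<^sub>R grad g y = y"
  proof (rule banach_fix_type[where c = "a * L"])
    show "\<forall>x. \<forall>y.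
        dist (z - a *\<^sub>R grad g x) (z - a *\<^sub>R grad g y) \<le> a * L * dist x y"
    proof (intro allI)
      fix x y
      have "dist (z - a *\<^sub>R grad g x) (z - a *\<^sub>R grad g y) = norm (a *\<^sub>R (grad g x - grad g y))"
        by (simp add: dist_norm norm_minus_commute scaleR_diff_right)
      also have "\<dots> \<le> a * (L * norm (x - y))"
        using a L_smooth_lipschitz[OF sm, of x y] by simp
      finally show "dist (z - a *\<^sub>R grad g x) (z - a *\<^sub>R grad g y) \<le> a * L * dist x y"
        by (simp add: dist_norm)
    qed
  qed (use a L in \<open>auto\<close>)
  then obtain y0 where y0: "z - a *\<^sub>R grad g y0 = y0" by blast
  \<comment> \<open>The tangent inequality at \<open>y0\<close> cancels the cross term of the
    expanded square, leaving a surplus of \<open>1/2 |y - y0|^2\<close>.\<close>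
  have "?\<psi> y0 \<le> ?\<psi> y" for y
  proof -
    have "a * (g y0 + inner (y - y0) (grad g y0)) \<le> a * g y"
      using convex_GDERIV_le[OF cvx L_smooth_GDERIV[OF sm], of y0 y] a by simp
    then have "a * g y0 + a * inner (y - y0) (grad g y0) \<le> a * g y" by (simp only: distrib_left)
    moreover have "a * inner (y - y0) (grad g y0) = inner (y - y0) (z - y0)"
      using y0 by (metis add_diff_cancel_left' diff_add_cancel inner_scaleR_right)
    moreover have "(norm (y - z))\<^sup>2 = (norm (y - y0))\<^sup>2 + (norm (y0 - z))\<^sup>2 - 2 * inner (y - y0) (z - y0)"
      by (simp add: power2_norm_eq_inner inner_simps inner_commute)
    moreover have "0 \<le> (norm (y - y0))\<^sup>2" by simp
    ultimately show ?thesis by linarith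
  qed
  then have "is_arg_min ?\<psi> (\<lambda>_. True) y0" by (simp add: is_arg_min_linorder)
  then have "is_arg_min ?\<psi> (\<lambda>_. True) (prox (\<lambda>y. a * g y) z)"
    unfolding prox_def arg_min_def by (rule someI)
  then have "?\<psi> (prox (\<lambda>y. a * g y) z) \<le> ?\<psi> y" for y by (simp add: is_arg_min_linorder)
  moreover have "GDERIV ?\<psi> p :> a *\<^sub>R grad g p + (p - z)" for p
    using L_smooth_GDERIV[OF sm, of p] unfolding gderiv_def power2_norm_eq_inner
    by (auto intro!: derivative_eq_intros simp: inner_simps inner_commute)
  ultimately have "a *\<^sub>R grad g (prox (\<lambda>y. a * g y) z) + (prox (\<lambda>y. a * g y) z - z) = 0"
    using GDERIV_minimum_eq_0 by blast
  then show ?thesis by (simp add: algebra_simps)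
qed

section \<open>Mean progress of one step\<close>

text \<open>In use, \<open>e\<close> is the correction \<open>grad F u - grad (f i) u\<close>. The
  final term involves the gradient at the old point \<open>x\<close>, not at the prox point, so it
  can be averaged over the index.\<close>

lemma prox_step_bound:
  fixes g :: "'a::{real_inner, banach} \<Rightarrow> real"
  assumes sm: "L_smooth L g" and cvx: "convex_on UNIV g" and a: "0 < a" "a * L < 1" and L: "L > 0"
  shows "(norm (prox (\<lambda>z. a * g z) (x - a *\<^sub>R e) - y))\<^sup>2
    \<le> (norm (x - y))\<^sup>2 - 2 * a * (g x - g y) - 2 * a * inner e (x - y)
      + a\<^sup>2 * (norm (grad g x + e))\<^sup>2"
proof -
  define q where "q = prox (\<lambda>z. a * g z) (x - a *\<^sub>R e)"
  define s where "s = q - x"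
  define w where "w = grad g x + e"
  have s: "s = - a *\<^sub>R (grad g q + e)"
    using prox_stationary[OF sm cvx a L, of "x - a *\<^sub>R e"] unfolding s_def q_def
    by (simp add: algebra_simps)
  \<comment> \<open>Two tangents: the one at \<open>q\<close> compares with \<open>y\<close>, the
    one at \<open>x\<close> compares with \<open>q\<close>. Their sum moves the function gap from
    the new point back to \<open>x\<close>.\<close>
  have "g q + inner (y - q) (grad g q) \<le> g y" "g x + inner s (grad g x) \<le> g q"
    unfolding s_def by (intro convex_GDERIV_le[OF cvx] L_smooth_GDERIV[OF sm])+
  then have "2 * a * (g x - g y) \<le> 2 * a * (inner (q - y) (grad g q) - inner s (grad g x))"
    using a by (intro mult_left_mono) (auto simp: inner_diff_left)
  moreover have "2 * inner s (q - y) = - 2 * a * inner (q - y) (grad g q) - 2 * a * inner e (q - y)"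
    unfolding s by (simp add: inner_add_left inner_commute algebra_simps)
  moreover have "inner e (q - y) = inner e (x - y) + inner e s"
    by (simp add: s_def inner_diff_right)
  moreover have "(norm (q - y))\<^sup>2 = (norm (x - y))\<^sup>2 - (norm s)\<^sup>2 + 2 * inner s (q - y)"
    by (simp add: s_def power2_norm_eq_inner inner_simps inner_commute)
  \<comment> \<open>This square absorbs everything left in \<open>s\<close>: it gives
    \<open>- |s|^2 - 2 a <s, w> \<le> a^2 |w|^2\<close>.\<close>
  moreover have "0 \<le> (norm (s + a *\<^sub>R w))\<^sup>2" by simp
  then have "0 \<le> (norm s)\<^sup>2 + 2 * a * inner s (grad g x) + 2 * a * inner e s + a\<^sup>2 * (norm w)\<^sup>2"
    unfolding w_def power2_norm_eq_inner
    by (simp add: inner_add_left inner_add_right inner_commute power2_eq_square algebra_simps)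
  ultimately show ?thesis unfolding q_def[symmetric] w_def[symmetric] by (simp add: algebra_simps)
qed

section \<open>The finite sum \<open>F\<close> and averages over the index, relative to a fixed
  minimizer \<open>y\<close>\<close>

locale convex_smooth_sum =
  fixes f :: "nat \<Rightarrow> 'a::{real_inner, banach} \<Rightarrow> real" and F :: "'a \<Rightarrow> real"
    and n :: nat and L :: real and y :: 'a
  assumes n: "n \<ge> 1"
    and F_def: "\<And>z. F z = 1 / real n * (\<Sum>i=1..n. f i z)"
    and L: "L > 0"
    and cvx: "\<And>i. i \<in> {1..n} \<Longrightarrow> convex_on UNIV (f i)"
    and sm: "\<And>i. i \<in> {1..n} \<Longrightarrow> L_smooth L (f i)"
    and min: "\<And>z. F y \<le> F z"
begin

text \<open>The error of the stored gradients at a reference point \<open>v\<close>, measured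
  against those at the minimizer; at the initial point it is \<open>\<sigma>0_sq\<close>.\<close>

definition \<sigma>2 :: "'a \<Rightarrow> real" where
  "\<sigma>2 v = 1 / real n * (\<Sum>i=1..n. (norm (grad (f i) v - grad (f i) y))\<^sup>2)"

lemma \<sigma>2_nonneg: "0 \<le> \<sigma>2 v"
  by (simp add: \<sigma>2_def sum_nonneg)

lemma sum_f: "(\<Sum>i=1..n. f i z) = real n * F z"
  using n by (simp add: F_def)

lemma GDERIV_F: "GDERIV F z :> (1 / real n) *\<^sub>R (\<Sum>i=1..n. grad (f i) z)"
proof -
  have "((\<lambda>z. 1 / real n * (\<Sum>i=1..n. f i z)) has_derivative
      (\<lambda>h. 1 / real n * (\<Sum>i=1..n. inner h (grad (f i) z)))) (at z)"
    by (intro has_derivative_mult_right has_derivative_sum)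
       (use L_smooth_GDERIV[OF sm] in \<open>simp add: gderiv_def\<close>)
  moreover have "F = (\<lambda>z. 1 / real n * (\<Sum>i=1..n. f i z))" by (rule ext) (rule F_def)
  ultimately show ?thesis by (simp add: gderiv_def inner_sum_right)
qed

lemma sum_grad: "(\<Sum>i=1..n. grad (f i) z) = real n *\<^sub>R grad F z"
  using n by (simp add: grad_eqI[OF GDERIV_F])

lemma grad_F_min: "grad F y = 0"
  using GDERIV_minimum_eq_0[OF GDERIV_F min] grad_eqI[OF GDERIV_F] by metis

lemma continuous_F: "continuous_on UNIV F"
  using GDERIV_F by (auto simp: gderiv_def intro!: has_derivative_continuous continuous_at_imp_continuous_on)

lemma convex_F: "convex_on UNIV F"
proof (rule convex_onI)
  fix t a b assume t: "0 < (t::real)" "t < 1"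
  have "F ((1 - t) *\<^sub>R a + t *\<^sub>R b) \<le> 1 / real n * (\<Sum>i=1..n. (1 - t) * f i a + t * f i b)"
    unfolding F_def using t by (intro mult_left_mono sum_mono convex_onD[OF cvx]) auto
  also have "\<dots> = (1 - t) * F a + t * F b"
    unfolding F_def by (simp add: sum.distrib sum_distrib_left sum_divide_distrib add_divide_distrib)
  finally show "F ((1 - t) *\<^sub>R a + t *\<^sub>R b) \<le> (1 - t) * F a + t * F b" .
qed simp

text \<open>Cocoercivity with base point \<open>y\<close>, averaged over \<open>i\<close>; the
  linear terms sum to zero because \<open>grad F y = 0\<close>.\<close>

lemma \<sigma>2_le: "\<sigma>2 v \<le> 2 * L * (F v - F y)"
proof -
  have "(\<Sum>i=1..n. (norm (grad (f i) v - grad (f i) y))\<^sup>2)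
      \<le> (\<Sum>i=1..n. 2 * L * (f i v - f i y - inner (v - y) (grad (f i) y)))"
    by (intro sum_mono cocoercivity sm cvx L)
  also have "\<dots> = 2 * L * ((\<Sum>i=1..n. f i v) - (\<Sum>i=1..n. f i y)
      - inner (v - y) (\<Sum>i=1..n. grad (f i) y))"
    by (simp add: sum_distrib_left[symmetric] sum_subtractf inner_sum_right)
  also have "\<dots> = real n * (2 * L * (F v - F y))"
    unfolding sum_f sum_grad grad_F_min by (simp add: algebra_simps)
  finally show ?thesis using n by (simp add: \<sigma>2_def field_simps)
qed

text \<open>The gradient estimate splits into \<open>A i\<close>, whose mean square is
  \<open>\<sigma>2 x\<close>, and the centered term \<open>grad F u - C i\<close>, whose mean square
  is at most \<open>\<sigma>2 u\<close>. The factors 2 come from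
  \<open>|a + b|^2 \<le> 2 |a|^2 + 2 |b|^2\<close>.\<close>

lemma sum_norm_le:
  "(\<Sum>i=1..n. (norm (grad (f i) x + (grad F u - grad (f i) u)))\<^sup>2)
    \<le> real n * (4 * L * (F x - F y) + 2 * \<sigma>2 u)"
proof -
  define A where "A i = grad (f i) x - grad (f i) y" for i
  define C where "C i = grad (f i) u - grad (f i) y" for i
  have "(norm (grad (f i) x + (grad F u - grad (f i) u)))\<^sup>2
      \<le> 2 * (norm (A i))\<^sup>2 + (2 * (norm (grad F u))\<^sup>2 - 4 * inner (C i) (grad F u) + 2 * (norm (C i))\<^sup>2)"
    for i
  proof -
    have "0 \<le> (norm (A i - (grad F u - C i)))\<^sup>2" by simp
    moreover have "grad (f i) x + (grad F u - grad (f i) u) = A i + (grad F u - C i)"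
      by (simp add: A_def C_def)
    ultimately show ?thesis
      unfolding \<open>grad (f i) x + _ = _\<close> power2_norm_eq_inner by (simp add: inner_simps inner_commute)
  qed
  then have "(\<Sum>i=1..n. (norm (grad (f i) x + (grad F u - grad (f i) u)))\<^sup>2)
    \<le> (\<Sum>i=1..n. 2 * (norm (A i))\<^sup>2
        + (2 * (norm (grad F u))\<^sup>2 - 4 * inner (C i) (grad F u) + 2 * (norm (C i))\<^sup>2))"
    by (rule sum_mono)
  also have "\<dots> = 2 * (\<Sum>i=1..n. (norm (A i))\<^sup>2) + real n * (2 * (norm (grad F u))\<^sup>2)
      - 4 * inner (\<Sum>i=1..n. C i) (grad F u) + 2 * (\<Sum>i=1..n. (norm (C i))\<^sup>2)"
    by (simp add: sum.distrib sum_subtractf sum_distrib_left inner_sum_left)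
  \<comment> \<open>The mean of \<open>C i\<close> is \<open>grad F u\<close> since the gradients at
    \<open>y\<close> sum to zero; the cross term then outweighs
    \<open>2 |grad F u|^2\<close>.\<close>
  also have "(\<Sum>i=1..n. C i) = real n *\<^sub>R grad F u"
    unfolding C_def sum_subtractf sum_grad by (simp add: grad_F_min)
  also have "(\<Sum>i=1..n. (norm (A i))\<^sup>2) = real n * \<sigma>2 x"
    using n by (simp add: A_def \<sigma>2_def)
  also have "(\<Sum>i=1..n. (norm (C i))\<^sup>2) = real n * \<sigma>2 u"
    using n by (simp add: C_def \<sigma>2_def)
  finally have "(\<Sum>i=1..n. (norm (grad (f i) x + (grad F u - grad (f i) u)))\<^sup>2)
    \<le> real n * (2 * \<sigma>2 x + 2 * \<sigma>2 u - 2 * (norm (grad F u))\<^sup>2)"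
    by (simp add: power2_norm_eq_inner algebra_simps)
  also have "\<dots> \<le> real n * (4 * L * (F x - F y) + 2 * \<sigma>2 u)"
    using \<sigma>2_le[of x] zero_le_power2[of "norm (grad F u)"] by (intro mult_left_mono) linarith+
  finally show ?thesis .
qed

lemma svrp_step_mean:
  assumes a: "0 < a" "a * L < 1"
  shows "(\<Sum>i=1..n. 1 / real n *
      (norm (prox (\<lambda>z. a * f i z) (x + a *\<^sub>R grad (f i) u - a *\<^sub>R grad F u) - y))\<^sup>2)
    \<le> (norm (x - y))\<^sup>2 - 2 * a * (1 - 2 * a * L) * (F x - F y) + 2 * a\<^sup>2 * \<sigma>2 u"
proof -
  define e where "e i = grad F u - grad (f i) u" for i
  define P where "P i = prox (\<lambda>z. a * f i z) (x + a *\<^sub>R grad (f i) u - a *\<^sub>R grad F u)" for i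
  have "(norm (P i - y))\<^sup>2 \<le> (norm (x - y))\<^sup>2 - 2 * a * (f i x - f i y) - 2 * a * inner (e i) (x - y)
      + a\<^sup>2 * (norm (grad (f i) x + e i))\<^sup>2" if "i \<in> {1..n}" for i
    using prox_step_bound[OF sm[OF that] cvx[OF that] a L, of x "e i" y]
    by (simp add: P_def e_def algebra_simps)
  then have "(\<Sum>i=1..n. (norm (P i - y))\<^sup>2)
    \<le> (\<Sum>i=1..n. (norm (x - y))\<^sup>2 - 2 * a * (f i x - f i y) - 2 * a * inner (e i) (x - y)
      + a\<^sup>2 * (norm (grad (f i) x + e i))\<^sup>2)"
    by (rule sum_mono)
  also have "\<dots> = real n * (norm (x - y))\<^sup>2 - 2 * a * ((\<Sum>i=1..n. f i x) - (\<Sum>i=1..n. f i y))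
      - 2 * a * inner (\<Sum>i=1..n. e i) (x - y)
      + a\<^sup>2 * (\<Sum>i=1..n. (norm (grad (f i) x + e i))\<^sup>2)"
    by (simp add: sum.distrib sum_subtractf sum_distrib_left inner_sum_left algebra_simps)
  \<comment> \<open>The corrections are unbiased, so the inner product with \<open>x - y\<close>
    disappears in the mean.\<close>
  also have "(\<Sum>i=1..n. e i) = 0"
    unfolding e_def sum_subtractf sum_grad by (simp add: sum_constant_scaleR)
  also have "a\<^sup>2 * (\<Sum>i=1..n. (norm (grad (f i) x + e i))\<^sup>2)
      \<le> a\<^sup>2 * (real n * (4 * L * (F x - F y) + 2 * \<sigma>2 u))"
    unfolding e_def by (intro mult_left_mono sum_norm_le) simp
  finally have "(\<Sum>i=1..n. (norm (P i - y))\<^sup>2)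
    \<le> real n * ((norm (x - y))\<^sup>2 - 2 * a * (1 - 2 * a * L) * (F x - F y) + 2 * a\<^sup>2 * \<sigma>2 u)"
    unfolding sum_f by (simp add: power2_eq_square[of a] algebra_simps)
  then show ?thesis
    unfolding P_def[symmetric] sum_distrib_left[symmetric] using n by (simp add: field_simps)
qed

end

section \<open>Expectations over finitely many sample histories\<close>

context prob_space
begin

text \<open>Almost surely \<open>g (H \<omega>)\<close> equals a finite combination of indicators.
  Since \<open>H\<close> takes values in a discrete space, \<open>g\<close> may be arbitrary, in
  particular built from \<open>prox\<close> and gradients.\<close>

lemma
  fixes g :: "'b \<Rightarrow> real"
  assumes meas: "H \<in> measurable M (count_space UNIV)"
    and fin: "finite S" and AE_S: "AE \<omega> in M. H \<omega> \<in> S"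
  shows integrable_finite_range: "integrable M (\<lambda>\<omega>. g (H \<omega>))"
    and expectation_finite_range:
      "expectation (\<lambda>\<omega>. g (H \<omega>)) = (\<Sum>h\<in>S. g h * prob (H -` {h} \<inter> space M))"
proof -
  let ?G = "\<lambda>\<omega>. \<Sum>h\<in>S. g h * indicator (H -` {h} \<inter> space M) \<omega>"
  have ev: "H -` {h} \<inter> space M \<in> events" for h
    using measurable_sets[OF meas, of "{h}"] by simp
  have gm: "(\<lambda>\<omega>. g (H \<omega>)) \<in> borel_measurable M"
    by (rule measurable_compose[OF meas]) simp
  have Gm: "?G \<in> borel_measurable M" using ev by measurable
  have eq: "AE \<omega> in M. g (H \<omega>) = ?G \<omega>"
    using AE_S AE_space
  proof eventually_elim
    case (elim \<omega>)
    then have "?G \<omega> = (\<Sum>h\<in>S. if h = H \<omega> then g h else 0)"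
      by (intro sum.cong) (auto simp: indicator_def)
    with elim fin show ?case by simp
  qed
  have G: "has_bochner_integral M ?G (\<Sum>h\<in>S. g h * prob (H -` {h} \<inter> space M))"
    by (intro has_bochner_integral_sum has_bochner_integral_mult_right
        has_bochner_integral_real_indicator ev) (simp add: emeasure_eq_measure)
  show "integrable M (\<lambda>\<omega>. g (H \<omega>))"
    using integrable_cong_AE[OF gm Gm eq] G by (simp add: has_bochner_integral_iff)
  show "expectation (\<lambda>\<omega>. g (H \<omega>)) = (\<Sum>h\<in>S. g h * prob (H -` {h} \<inter> space M))"
    using integral_cong_AE[OF gm Gm eq] G by (simp add: has_bochner_integral_iff)
qed

text \<open>An elementary form of conditioning on \<open>H\<close>: on each atom of
  \<open>H\<close>, the independent variable \<open>Y\<close> is averaged out by its own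
  law.\<close>

lemma expectation_indep_finite_range:
  fixes g :: "'b::countable \<Rightarrow> 'c::countable \<Rightarrow> real"
  assumes H: "H \<in> measurable M (count_space UNIV)" and S: "finite S" "AE \<omega> in M. H \<omega> \<in> S"
    and Y: "Y \<in> measurable M (count_space UNIV)" and T: "finite T" "AE \<omega> in M. Y \<omega> \<in> T"
    and indep: "\<And>h y. prob ((Y -` {y} \<inter> space M) \<inter> (H -` {h} \<inter> space M))
      = prob (Y -` {y} \<inter> space M) * prob (H -` {h} \<inter> space M)"
  shows "expectation (\<lambda>\<omega>. g (H \<omega>) (Y \<omega>))
    = expectation (\<lambda>\<omega>. \<Sum>y\<in>T. prob (Y -` {y} \<inter> space M) * g (H \<omega>) y)"
proof -
  let ?Z = "\<lambda>\<omega>. (H \<omega>, Y \<omega>)"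
  have "?Z \<in> measurable M (count_space UNIV \<Otimes>\<^sub>M count_space UNIV)"
    by (intro measurable_Pair H Y)
  \<comment> \<open>Both value types are countable, so the product of the discrete sigma-algebras is
    again discrete.\<close>
  then have Z: "?Z \<in> measurable M (count_space UNIV)"
    by (simp add: pair_measure_countable)
  have "AE \<omega> in M. ?Z \<omega> \<in> S \<times> T" using S(2) T(2) by eventually_elim simp
  from expectation_finite_range[OF Z _ this, of "\<lambda>(h, y). g h y"] S(1) T(1)
  have "expectation (\<lambda>\<omega>. g (H \<omega>) (Y \<omega>))
      = (\<Sum>(h, y)\<in>S \<times> T. g h y * prob (?Z -` {(h, y)} \<inter> space M))"
    by (simp add: case_prod_unfold)
  also have "\<dots> = (\<Sum>h\<in>S. \<Sum>y\<in>T. g h y * prob (?Z -` {(h, y)} \<inter> space M))"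
    by (rule sum.cartesian_product[symmetric])
  also have "\<dots> = (\<Sum>h\<in>S. \<Sum>y\<in>T. g h y * (prob (Y -` {y} \<inter> space M) * prob (H -` {h} \<inter> space M)))"
  proof (intro sum.cong refl)
    fix h y
    have "?Z -` {(h, y)} \<inter> space M = (Y -` {y} \<inter> space M) \<inter> (H -` {h} \<inter> space M)" by auto
    then show "g h y * prob (?Z -` {(h, y)} \<inter> space M)
        = g h y * (prob (Y -` {y} \<inter> space M) * prob (H -` {h} \<inter> space M))"
      by (simp only: indep)
  qed
  also have "\<dots> = (\<Sum>h\<in>S. (\<Sum>y\<in>T. prob (Y -` {y} \<inter> space M) * g h y) * prob (H -` {h} \<inter> space M))"
    by (simp add: sum_distrib_left sum_distrib_right mult_ac)
  also have "\<dots> = expectation (\<lambda>\<omega>. \<Sum>y\<in>T. prob (Y -` {y} \<inter> space M) * g (H \<omega>) y)"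
    by (rule expectation_finite_range[OF H S, symmetric])
  finally show ?thesis .
qed

lemma prob_eq_pmf:
  assumes "Y \<in> measurable M (count_space UNIV)" and "distr M (count_space UNIV) Y = measure_pmf q"
  shows "prob (Y -` {y} \<inter> space M) = pmf q y"
  using measure_distr[OF assms(1), of "{y}"] by (simp add: assms(2) pmf.rep_eq)

lemma AE_in_set_pmf:
  assumes "Y \<in> measurable M (count_space UNIV)" and "distr M (count_space UNIV) Y = measure_pmf q"
  shows "AE \<omega> in M. Y \<omega> \<in> set_pmf q"
proof (rule AE_distrD[OF assms(1)])
  show "AE y in distr M (count_space UNIV) Y. y \<in> set_pmf q"
    unfolding assms(2) by (rule AE_pmfI)
qed

end

section \<open>Sample histories and the filtration they generate\<close>

primrec history :: "(nat \<Rightarrow> 'w \<Rightarrow> 'b) \<Rightarrow> (nat \<Rightarrow> 'w \<Rightarrow> 'c) \<Rightarrow> nat \<Rightarrow> 'w \<Rightarrow> ('b \<times> 'c) list" where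
  "history X Y 0 \<omega> = []"
| "history X Y (Suc k) \<omega> = (X k \<omega>, Y k \<omega>) # history X Y k \<omega>"

lemma sigma_algebra_past_events: "sigma_algebra (space P) (past_events P idx eps k)"
  unfolding past_events_def by (rule sigma_algebra_sigma_sets) auto

lemma past_events_Suc: "past_events P idx eps k \<subseteq> past_events P idx eps (Suc k)"
proof -
  have "{idx j -` A \<inter> space P | j A. j < k} \<subseteq> {idx j -` A \<inter> space P | j A. j < Suc k}"
    "{eps j -` A \<inter> space P | j A. j < k} \<subseteq> {eps j -` A \<inter> space P | j A. j < Suc k}"
    using less_SucI by blast+
  then show ?thesis unfolding past_events_def by (intro sigma_sets_mono' Un_mono)
qed

text \<open>Fixing a history fixes each past sample, so the event is a finite intersection of
  generators, built up by induction on \<open>k\<close>.\<close>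

lemma history_in_past_events: "history idx eps k -` {h} \<inter> space P \<in> past_events P idx eps k"
proof (induction k arbitrary: h)
  case 0
  interpret sigma_algebra "space P" "past_events P idx eps 0" by (rule sigma_algebra_past_events)
  show ?case by (cases "h = []") (auto simp: vimage_def)
next
  case (Suc k)
  interpret sigma_algebra "space P" "past_events P idx eps (Suc k)"
    by (rule sigma_algebra_past_events)
  show ?case
  proof (cases h)
    case Nil
    then show ?thesis by (simp add: vimage_def)
  next
    case (Cons z h')
    have *: "idx k -` {fst z} \<inter> space P \<in> past_events P idx eps (Suc k)"
      "eps k -` {snd z} \<inter> space P \<in> past_events P idx eps (Suc k)"
      unfolding past_events_def by (rule sigma_sets.Basic, blast)+
    have "history idx eps k -` {h'} \<inter> space P \<in> past_events P idx eps (Suc k)"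
      using Suc.IH past_events_Suc by blast
    then have "(idx k -` {fst z} \<inter> space P) \<inter> (eps k -` {snd z} \<inter> space P)
        \<inter> (history idx eps k -` {h'} \<inter> space P) \<in> past_events P idx eps (Suc k)"
      by (rule Int[OF Int[OF *]])
    also have "(idx k -` {fst z} \<inter> space P) \<inter> (eps k -` {snd z} \<inter> space P)
        \<inter> (history idx eps k -` {h'} \<inter> space P) = history idx eps (Suc k) -` {h} \<inter> space P"
      unfolding Cons by (cases z) (auto simp: vimage_def)
    finally show ?thesis .
  qed
qed

text \<open>Independence makes all past events measurable, and lists of samples form a countable
  type, so preimages of singletons suffice.\<close>

lemma (in prob_space) history_measurable:
  fixes idx :: "nat \<Rightarrow> 'a \<Rightarrow> nat" and eps :: "nat \<Rightarrow> 'a \<Rightarrow> bool"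
  assumes "indep_set A (past_events M idx eps k)"
  shows "history idx eps k \<in> measurable M (count_space UNIV)"
  using indep_setD_ev2[OF assms] history_in_past_events[of idx eps k _ M]
  by (subst measurable_count_space_eq2_countable) auto

lemma (in prob_space) prob_history_indep:
  assumes "indep_set (generated_events M Y) (past_events M idx eps k)"
  shows "prob ((Y -` {y} \<inter> space M) \<inter> (history idx eps k -` {h} \<inter> space M))
      = prob (Y -` {y} \<inter> space M) * prob (history idx eps k -` {h} \<inter> space M)"
  by (rule indep_setD[OF assms _ history_in_past_events]) (auto simp: generated_events_def)

section \<open>Convergence of the averaged iterates\<close>

context convex_smooth_sum
begin

text \<open>The pair of current point and reference point as a deterministic function of the
  samples, newest first; both components start at \<open>z\<close>, and both updates read the old
  pair.\<close>

primrec svrp :: "real \<Rightarrow> 'a \<Rightarrow> (nat \<times> bool) list \<Rightarrow> 'a \<times> 'a" where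
  "svrp \<alpha> z [] = (z, z)"
| "svrp \<alpha> z (s # h) = (let (x, u) = svrp \<alpha> z h; (i, b) = s in
    (prox (\<lambda>v. \<alpha> * f i v) (x + \<alpha> *\<^sub>R grad (f i) u - \<alpha> *\<^sub>R grad F u),
     (1 - of_bool b) *\<^sub>R u + of_bool b *\<^sub>R x))"

lemma jensen_average:
  assumes "k \<ge> 1"
  shows "F ((1 / real k) *\<^sub>R (\<Sum>t<k. v t)) - F y \<le> 1 / real k * (\<Sum>t<k. F (v t) - F y)"
proof -
  have "F (\<Sum>t<k. (1 / real k) *\<^sub>R v t) \<le> (\<Sum>t<k. 1 / real k * F (v t))"
    by (rule convex_on_sum[OF _ _ convex_F]) (use assms in \<open>auto simp: lessThan_empty_iff\<close>)
  then show ?thesis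
    using assms by (simp add: scaleR_right.sum sum_divide_distrib[symmetric] sum_subtractf field_simps)
qed

end

section \<open>The random iterates and their expectations\<close>

locale svrp_process = convex_smooth_sum f F n L y + prob_space P
  for f :: "nat \<Rightarrow> 'a::{real_inner, banach, second_countable_topology} \<Rightarrow> real"
    and F :: "'a \<Rightarrow> real" and n L y and P :: "'w measure" +
  fixes idx :: "nat \<Rightarrow> 'w \<Rightarrow> nat" and eps :: "nat \<Rightarrow> 'w \<Rightarrow> bool"
    and x u :: "nat \<Rightarrow> 'w \<Rightarrow> 'a" and x0 :: 'a and p \<alpha> M :: real
  assumes p: "0 < p" "p \<le> 1"
    and idx_rv: "\<And>k. idx k \<in> measurable P (count_space UNIV)"
    and eps_rv: "\<And>k. eps k \<in> measurable P (count_space UNIV)"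
    and idx_uniform: "\<And>k. distr P (count_space UNIV) (idx k) = measure_pmf (pmf_of_set {1..n})"
    and eps_bernoulli: "\<And>k. distr P (count_space UNIV) (eps k) = measure_pmf (bernoulli_pmf p)"
    and idx_indep: "\<And>k. indep_set (generated_events P (idx k)) (past_events P idx eps k)"
    and eps_indep: "\<And>k. indep_set (generated_events P (eps k)) (past_events P idx eps k)"
    and x_init: "\<And>\<omega>. \<omega> \<in> space P \<Longrightarrow> x 0 \<omega> = x0"
    and u_init: "\<And>\<omega>. \<omega> \<in> space P \<Longrightarrow> u 0 \<omega> = x0"
    and x_step: "\<And>k \<omega>. \<omega> \<in> space P \<Longrightarrow>
      x (Suc k) \<omega> = prox (\<lambda>z. \<alpha> * f (idx k \<omega>) z)
        (x k \<omega> + \<alpha> *\<^sub>R grad (f (idx k \<omega>)) (u k \<omega>) - \<alpha> *\<^sub>R grad F (u k \<omega>))"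
    and u_step: "\<And>k \<omega>. \<omega> \<in> space P \<Longrightarrow>
      u (Suc k) \<omega> = (1 - of_bool (eps k \<omega>)) *\<^sub>R u k \<omega> + of_bool (eps k \<omega>) *\<^sub>R x k \<omega>"
    and M: "M \<ge> 2 / p"
    and \<alpha>: "0 < \<alpha>" "\<alpha> < 1 / (L * (2 + p * M))"
begin

abbreviation H where "H k \<equiv> history idx eps k"

lemma H_rv: "H k \<in> measurable P (count_space UNIV)"
  by (rule history_measurable[OF idx_indep])

lemma AE_idx: "AE \<omega> in P. idx k \<omega> \<in> {1..n}"
  using AE_in_set_pmf[OF idx_rv idx_uniform, of k] n by simp

lemma AE_H: "AE \<omega> in P. H k \<omega> \<in> {h. set h \<subseteq> {1..n} \<times> UNIV \<and> length h = k}"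
proof (induction k)
  case (Suc k)
  then show ?case using AE_idx[of k] by eventually_elim auto
qed simp

lemma finite_H: "finite {h :: (nat \<times> bool) list. set h \<subseteq> {1..n} \<times> UNIV \<and> length h = k}"
  by (rule finite_lists_length_eq) simp

lemma iterates_eq:
  assumes "\<omega> \<in> space P"
  shows "x k \<omega> = fst (svrp \<alpha> x0 (H k \<omega>)) \<and> u k \<omega> = snd (svrp \<alpha> x0 (H k \<omega>))"
  by (induction k) (auto simp: x_init[OF assms] u_init[OF assms] x_step[OF assms] u_step[OF assms]
      case_prod_unfold Let_def)

lemma iterates_measurable [measurable]: "x k \<in> borel_measurable P"
proof -
  have "(\<lambda>\<omega>. fst (svrp \<alpha> x0 (H k \<omega>))) \<in> borel_measurable P"
    by (rule measurable_compose[OF H_rv]) simp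
  then show ?thesis by (subst measurable_cong[OF conjunct1[OF iterates_eq]])
qed

text \<open>The pair of iterates is a function of the history, which almost surely lies in a finite
  set; hence \<open>g\<close> can be any real function.\<close>

lemma integrable_iterates:
  fixes g :: "'a \<Rightarrow> 'a \<Rightarrow> real"
  shows "integrable P (\<lambda>\<omega>. g (x k \<omega>) (u k \<omega>))"
  using integrable_finite_range[OF H_rv finite_H AE_H,
      where g = "\<lambda>h. g (fst (svrp \<alpha> x0 h)) (snd (svrp \<alpha> x0 h))", of k]
  by (simp add: iterates_eq cong: Bochner_Integration.integrable_cong)

lemma integrable_distance: "integrable P (\<lambda>\<omega>. (norm (x k \<omega> - y))\<^sup>2)"
  and integrable_gap: "integrable P (\<lambda>\<omega>. F (x k \<omega>) - F y)"
  and integrable_\<sigma>2: "integrable P (\<lambda>\<omega>. \<sigma>2 (u k \<omega>))"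
  by (rule integrable_iterates)+

text \<open>Given the past, the new index is uniform. The next point depends on the past and
  \<open>idx k\<close> alone, the next reference point on the past and \<open>eps k\<close> alone,
  so the two kinds of samples are averaged separately.\<close>

lemma expectation_idx:
  "expectation (\<lambda>\<omega>. g (x k \<omega>) (u k \<omega>) (idx k \<omega>))
    = expectation (\<lambda>\<omega>. \<Sum>i=1..n. 1 / real n * g (x k \<omega>) (u k \<omega>) i)"
proof -
  have "prob (idx k -` {i} \<inter> space P) = 1 / real n" if "i \<in> {1..n}" for i
    using prob_eq_pmf[OF idx_rv idx_uniform, of k i] n that by simp
  then show ?thesis
    using expectation_indep_finite_range[OF H_rv finite_H AE_H idx_rv _ AE_idx prob_history_indep[OF idx_indep],
      where g = "\<lambda>h. g (fst (svrp \<alpha> x0 h)) (snd (svrp \<alpha> x0 h))", of k]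
    by (simp add: iterates_eq cong: Bochner_Integration.integral_cong)
qed

lemma expectation_eps:
  "expectation (\<lambda>\<omega>. g (x k \<omega>) (u k \<omega>) (eps k \<omega>))
    = expectation (\<lambda>\<omega>. (1 - p) * g (x k \<omega>) (u k \<omega>) False + p * g (x k \<omega>) (u k \<omega>) True)"
proof -
  have "prob (eps k -` {b} \<inter> space P) = (if b then p else 1 - p)" for b
    using prob_eq_pmf[OF eps_rv eps_bernoulli, of k b] p by simp
  then show ?thesis
    using expectation_indep_finite_range[OF H_rv finite_H AE_H eps_rv _ _ prob_history_indep[OF eps_indep],
      where T = UNIV and g = "\<lambda>h. g (fst (svrp \<alpha> x0 h)) (snd (svrp \<alpha> x0 h))", of k]
    by (simp add: iterates_eq UNIV_bool cong: Bochner_Integration.integral_cong)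
qed

text \<open>The Lyapunov quantity. Its weight \<open>\<alpha>^2 M\<close> is such that the
  contraction of \<open>\<sigma>2\<close> by \<open>1 - p\<close> pays for the term
  \<open>2 \<alpha>^2 \<sigma>2\<close> of a step exactly when \<open>p M \<ge> 2\<close>.\<close>

definition V :: "nat \<Rightarrow> real" where
  "V k = expectation (\<lambda>\<omega>. (norm (x k \<omega> - y))\<^sup>2) + \<alpha>\<^sup>2 * M * expectation (\<lambda>\<omega>. \<sigma>2 (u k \<omega>))"

definition gap :: "nat \<Rightarrow> real" where
  "gap k = expectation (\<lambda>\<omega>. F (x k \<omega>) - F y)"

lemma pM: "2 \<le> p * M"
  using M p by (simp add: field_simps)

lemma rate_pos: "0 < 1 - \<alpha> * L * (2 + p * M)"
proof -
  have "0 < L * (2 + p * M)" using L pM by simp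
  from pos_less_divide_eq[OF this] have "\<alpha> * (L * (2 + p * M)) < 1" using \<alpha> by blast
  then show ?thesis by (simp only: mult.assoc)
qed

text \<open>The contraction condition under which the prox step satisfies its stationarity
  equation.\<close>

lemma \<alpha>L: "\<alpha> * L < 1"
proof -
  have "\<alpha> * L * 1 \<le> \<alpha> * L * (2 + p * M)"
    using \<alpha> L pM by (intro mult_left_mono) auto
  then show ?thesis using rate_pos by simp
qed

lemma distance_decrease:
  "expectation (\<lambda>\<omega>. (norm (x (Suc k) \<omega> - y))\<^sup>2)
    \<le> expectation (\<lambda>\<omega>. (norm (x k \<omega> - y))\<^sup>2) - 2 * \<alpha> * (1 - 2 * \<alpha> * L) * gap k
      + 2 * \<alpha>\<^sup>2 * expectation (\<lambda>\<omega>. \<sigma>2 (u k \<omega>))"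
proof -
  have "expectation (\<lambda>\<omega>. (norm (x (Suc k) \<omega> - y))\<^sup>2)
    = expectation (\<lambda>\<omega>. (norm (prox (\<lambda>z. \<alpha> * f (idx k \<omega>) z)
        (x k \<omega> + \<alpha> *\<^sub>R grad (f (idx k \<omega>)) (u k \<omega>) - \<alpha> *\<^sub>R grad F (u k \<omega>)) - y))\<^sup>2)"
    by (intro Bochner_Integration.integral_cong refl) (simp only: x_step)
  also have "\<dots> = expectation (\<lambda>\<omega>. \<Sum>i=1..n. 1 / real n * (norm (prox (\<lambda>z. \<alpha> * f i z)
        (x k \<omega> + \<alpha> *\<^sub>R grad (f i) (u k \<omega>) - \<alpha> *\<^sub>R grad F (u k \<omega>)) - y))\<^sup>2)"
    by (rule expectation_idx)
  also have "\<dots> \<le> expectation (\<lambda>\<omega>. (norm (x k \<omega> - y))\<^sup>2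
      - 2 * \<alpha> * (1 - 2 * \<alpha> * L) * (F (x k \<omega>) - F y) + 2 * \<alpha>\<^sup>2 * \<sigma>2 (u k \<omega>))"
    by (intro integral_mono integrable_iterates svrp_step_mean \<alpha> \<alpha>L)
  also have "\<dots> = expectation (\<lambda>\<omega>. (norm (x k \<omega> - y))\<^sup>2) - 2 * \<alpha> * (1 - 2 * \<alpha> * L) * gap k
      + 2 * \<alpha>\<^sup>2 * expectation (\<lambda>\<omega>. \<sigma>2 (u k \<omega>))"
    unfolding gap_def
    by (simp add: integrable_distance integrable_gap integrable_\<sigma>2)
  finally show ?thesis .
qed

text \<open>With probability \<open>1 - p\<close> the reference point stays; otherwise it becomes
  the current point, where \<open>\<sigma>2\<close> is controlled by the function gap.\<close>

lemma variance_decrease: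
  "expectation (\<lambda>\<omega>. \<sigma>2 (u (Suc k) \<omega>))
    \<le> (1 - p) * expectation (\<lambda>\<omega>. \<sigma>2 (u k \<omega>)) + 2 * p * L * gap k"
proof -
  have "expectation (\<lambda>\<omega>. \<sigma>2 (u (Suc k) \<omega>))
    = expectation (\<lambda>\<omega>. \<sigma>2 ((1 - of_bool (eps k \<omega>)) *\<^sub>R u k \<omega> + of_bool (eps k \<omega>) *\<^sub>R x k \<omega>))"
    by (intro Bochner_Integration.integral_cong refl) (simp only: u_step)
  also have "\<dots> = expectation (\<lambda>\<omega>. (1 - p) * \<sigma>2 (u k \<omega>) + p * \<sigma>2 (x k \<omega>))"
    by (subst expectation_eps[of "\<lambda>x u b. \<sigma>2 ((1 - of_bool b) *\<^sub>R u + of_bool b *\<^sub>R x)"]) simp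
  also have "\<dots> \<le> expectation (\<lambda>\<omega>. (1 - p) * \<sigma>2 (u k \<omega>) + p * (2 * L * (F (x k \<omega>) - F y)))"
    using p by (intro integral_mono integrable_iterates add_left_mono mult_left_mono \<sigma>2_le) auto
  also have "\<dots> = (1 - p) * expectation (\<lambda>\<omega>. \<sigma>2 (u k \<omega>)) + 2 * p * L * gap k"
    unfolding gap_def
    by (simp add: integrable_gap integrable_\<sigma>2)
  finally show ?thesis .
qed

lemma V_decrease: "V (Suc k) \<le> V k - 2 * \<alpha> * (1 - \<alpha> * L * (2 + p * M)) * gap k"
proof -
  define s where "s = expectation (\<lambda>\<omega>. \<sigma>2 (u k \<omega>))"
  have "0 < M" using M p by (smt (verit) divide_pos_pos)
  then have "\<alpha>\<^sup>2 * M * expectation (\<lambda>\<omega>. \<sigma>2 (u (Suc k) \<omega>))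
      \<le> \<alpha>\<^sup>2 * M * ((1 - p) * s + 2 * p * L * gap k)"
    unfolding s_def by (intro mult_left_mono variance_decrease) auto
  \<comment> \<open>The gap coefficients \<open>-2 \<alpha> (1 - 2 \<alpha> L)\<close> and
    \<open>2 \<alpha>^2 M p L\<close> combine into the rate; the coefficients of \<open>s\<close>
    leave \<open>- \<alpha>^2 (p M - 2)\<close>.\<close>
  with distance_decrease[of k]
  have "V (Suc k) \<le> V k - 2 * \<alpha> * (1 - \<alpha> * L * (2 + p * M)) * gap k - \<alpha>\<^sup>2 * (p * M - 2) * s"
    unfolding V_def s_def[symmetric] by (simp add: power2_eq_square algebra_simps)
  moreover have "0 \<le> s" unfolding s_def by (simp add: \<sigma>2_nonneg)
  then have "0 \<le> \<alpha>\<^sup>2 * (p * M - 2) * s" using pM by simp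
  ultimately show ?thesis by linarith
qed

text \<open>Telescoping of the decrease of \<open>V\<close>, whose last value is
  nonnegative.\<close>

lemma sum_gap_le: "2 * \<alpha> * (1 - \<alpha> * L * (2 + p * M)) * (\<Sum>t<k. gap t) \<le> V 0"
proof -
  have "2 * \<alpha> * (1 - \<alpha> * L * (2 + p * M)) * (\<Sum>t<k. gap t) \<le> V 0 - V k"
  proof (induction k)
    case (Suc k)
    then show ?case using V_decrease[of k] by (simp add: distrib_left)
  qed simp
  moreover have "0 \<le> V k"
  proof -
    have "0 \<le> M" using M p by (smt (verit) divide_pos_pos)
    then show ?thesis unfolding V_def by (intro add_nonneg_nonneg mult_nonneg_nonneg) (auto simp: \<sigma>2_nonneg)
  qed
  ultimately show ?thesis by linarith
qed

lemma V_0: "V 0 = (norm (x0 - y))\<^sup>2 + \<alpha>\<^sup>2 * M * \<sigma>2 x0"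
proof -
  have "expectation (\<lambda>\<omega>. (norm (x 0 \<omega> - y))\<^sup>2) = expectation (\<lambda>\<omega>. (norm (x0 - y))\<^sup>2)"
    "expectation (\<lambda>\<omega>. \<sigma>2 (u 0 \<omega>)) = expectation (\<lambda>\<omega>. \<sigma>2 x0)"
    by (intro Bochner_Integration.integral_cong refl; simp add: x_init u_init)+
  then show ?thesis by (simp add: V_def prob_space)
qed

theorem average_bound:
  assumes k: "k \<ge> 1"
  shows "integrable P (\<lambda>\<omega>. F ((1 / real k) *\<^sub>R (\<Sum>t<k. x t \<omega>)) - F y)" (is "integrable P ?G")
    and "expectation (\<lambda>\<omega>. F ((1 / real k) *\<^sub>R (\<Sum>t<k. x t \<omega>)) - F y)
      \<le> ((norm (x0 - y))\<^sup>2 + \<alpha>\<^sup>2 * M * \<sigma>2 x0) / (2 * \<alpha> * real k * (1 - \<alpha> * L * (2 + p * M)))"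
proof -
  have [measurable]: "F \<in> borel_measurable borel"
    using continuous_F by (rule borel_measurable_continuous_onI)
  have B: "integrable P (\<lambda>\<omega>. 1 / real k * (\<Sum>t<k. F (x t \<omega>) - F y))"
    by (intro integrable_mult_right Bochner_Integration.integrable_sum integrable_iterates)
  \<comment> \<open>The gap at the average is nonnegative by minimality and, by Jensen, dominated by
    the integrable average of the gaps.\<close>
  show int: "integrable P ?G"
  proof (rule Bochner_Integration.integrable_bound[OF B])
    show "AE \<omega> in P. norm (?G \<omega>) \<le> norm (1 / real k * (\<Sum>t<k. F (x t \<omega>) - F y))"
    proof (rule AE_I2)
      fix \<omega>
      show "norm (?G \<omega>) \<le> norm (1 / real k * (\<Sum>t<k. F (x t \<omega>) - F y))"
        using jensen_average[OF k, of "\<lambda>t. x t \<omega>"] min[of "(1 / real k) *\<^sub>R (\<Sum>t<k. x t \<omega>)"]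
        unfolding real_norm_def by linarith
    qed
  qed measurable
  have "expectation ?G \<le> expectation (\<lambda>\<omega>. 1 / real k * (\<Sum>t<k. F (x t \<omega>) - F y))"
    by (intro integral_mono int B jensen_average k)
  also have "\<dots> = 1 / real k * (\<Sum>t<k. gap t)"
    unfolding gap_def
    by (subst Bochner_Integration.integral_mult_right, intro Bochner_Integration.integrable_sum integrable_iterates)
       (subst Bochner_Integration.integral_sum, rule integrable_iterates, simp)
  also have "\<dots> \<le> V 0 / (2 * \<alpha> * real k * (1 - \<alpha> * L * (2 + p * M)))"
  proof -
    define c where "c = 2 * \<alpha> * (1 - \<alpha> * L * (2 + p * M))"
    have "0 < c" using rate_pos \<alpha> by (simp add: c_def)
    moreover have "c * (\<Sum>t<k. gap t) \<le> V 0" unfolding c_def by (rule sum_gap_le)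
    ultimately have "1 / real k * (\<Sum>t<k. gap t) \<le> V 0 / (real k * c)"
      using k by (simp add: field_simps)
    then show ?thesis by (simp add: c_def mult_ac)
  qed
  finally show "expectation ?G
      \<le> ((norm (x0 - y))\<^sup>2 + \<alpha>\<^sup>2 * M * \<sigma>2 x0) / (2 * \<alpha> * real k * (1 - \<alpha> * L * (2 + p * M)))"
    by (simp only: V_0)
qed

end

theorem corollary4p12:
  fixes f :: "nat \<Rightarrow> 'a::{real_inner, banach, second_countable_topology} \<Rightarrow> real"
    and F :: "'a \<Rightarrow> real"
    and n :: nat
    and L p \<alpha> M \<sigma>0_sq :: real
    and \<P> :: "'w measure"
    and idx :: "nat \<Rightarrow> 'w \<Rightarrow> nat"
    and eps :: "nat \<Rightarrow> 'w \<Rightarrow> bool"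
    and x u :: "nat \<Rightarrow> 'w \<Rightarrow> 'a"
    and x0 u0 y0 :: 'a
    and k :: nat
  assumes n: "n \<ge> 1"
    and F_def: "\<And>z. F z = 1 / real n * (\<Sum>i=1..n. f i z)"
    and argmin_nonempty: "argmin_set F \<noteq> {}"
    and L_pos: "L > 0"
    and convex: "\<And>i. i \<in> {1..n} \<Longrightarrow> convex_on UNIV (f i)"
    and smooth: "\<And>i. i \<in> {1..n} \<Longrightarrow> L_smooth L (f i)"
    and p: "0 < p" "p \<le> 1"
    and prob_space: "prob_space \<P>"
    and idx_indep: "prob_space.indep_vars \<P> (\<lambda>_. count_space UNIV) idx UNIV"
    and idx_uniform:
      "\<And>k. distr \<P> (count_space UNIV) (idx k) = measure_pmf (pmf_of_set {1..n})"
    and eps_indep: "prob_space.indep_vars \<P> (\<lambda>_. count_space UNIV) eps UNIV"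
    and eps_bernoulli:
      "\<And>k. distr \<P> (count_space UNIV) (eps k) = measure_pmf (bernoulli_pmf p)"
    and idx_indep_past:
      "\<And>k. prob_space.indep_set \<P> (generated_events \<P> (idx k)) (past_events \<P> idx eps k)"
    and eps_indep_past:
      "\<And>k. prob_space.indep_set \<P> (generated_events \<P> (eps k)) (past_events \<P> idx eps k)"
    and init_eq: "x0 = u0"
    and x_init: "\<And>\<omega>. \<omega> \<in> space \<P> \<Longrightarrow> x 0 \<omega> = x0"
    and u_init: "\<And>\<omega>. \<omega> \<in> space \<P> \<Longrightarrow> u 0 \<omega> = u0"
    and x_step: "\<And>k \<omega>. \<omega> \<in> space \<P> \<Longrightarrow>
      x (Suc k) \<omega> = prox (\<lambda>z. \<alpha> * f (idx k \<omega>) z)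
        (x k \<omega> + \<alpha> *\<^sub>R grad (f (idx k \<omega>)) (u k \<omega>) - \<alpha> *\<^sub>R grad F (u k \<omega>))"
    and u_step: "\<And>k \<omega>. \<omega> \<in> space \<P> \<Longrightarrow>
      u (Suc k) \<omega> = (1 - of_bool (eps k \<omega>)) *\<^sub>R u k \<omega> + of_bool (eps k \<omega>) *\<^sub>R x k \<omega>"
    and M: "M \<ge> 2 / p"
    and \<alpha>: "0 < \<alpha>" "\<alpha> < 1 / (L * (2 + p * M))"
    and y0: "y0 \<in> argmin_set F" "norm (u0 - y0) = infdist u0 (argmin_set F)"
    and \<sigma>0_sq_def:
      "\<sigma>0_sq = 1 / real n * (\<Sum>i=1..n. (norm (grad (f i) u0 - grad (f i) y0))\<^sup>2)"
    and k: "k \<ge> 1"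
  shows "integrable \<P> (\<lambda>\<omega>. F ((1 / real k) *\<^sub>R (\<Sum>t<k. x t \<omega>)) - Inf (range F)) \<and>
    (\<integral>\<omega>. F ((1 / real k) *\<^sub>R (\<Sum>t<k. x t \<omega>)) - Inf (range F) \<partial>\<P>)
      \<le> ((infdist x0 (argmin_set F))\<^sup>2 + \<alpha>\<^sup>2 * M * (\<integral>\<omega>. \<sigma>0_sq \<partial>\<P>))
          / (2 * \<alpha> * real k * (1 - \<alpha> * L * (2 + p * M)))"
proof -
  interpret prob_space \<P> by fact
  have min: "F y0 \<le> F z" for z
    using y0(1) by (simp add: argmin_set_def is_arg_min_linorder)
  \<comment> \<open>Choosing the minimizer nearest to the start turns \<open>norm (x0 - y0)\<close>
    into the distance to the set of minimizers.\<close>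
  interpret svrp_process f F n L y0 \<P> idx eps x u x0 p \<alpha> M
  proof unfold_locales
    show "idx k \<in> measurable \<P> (count_space UNIV)" "eps k \<in> measurable \<P> (count_space UNIV)" for k
      using idx_indep eps_indep by (auto simp: indep_vars_def)
    show "u 0 \<omega> = x0" if "\<omega> \<in> space \<P>" for \<omega>
      using u_init[OF that] init_eq by simp
  qed (fact assms min)+
  have "Inf (range F) = F y0"
    by (rule cInf_eq_minimum) (auto simp: min)
  moreover have "(\<integral>\<omega>. \<sigma>0_sq \<partial>\<P>) = \<sigma>2 x0"
    by (simp add: prob_space \<sigma>0_sq_def \<sigma>2_def init_eq)
  ultimately show ?thesis
    using average_bound[OF k] y0(2) init_eq by simp
qed

end
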